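(* Let $n \geq 1$ and let $y_1, \dots, y_n$ be positive integers. The number $f(\vec{y})$ of parking sequences for the car sizes $\vec{y} = (y_1, \dots, y_n)$ is \[ f(\vec{y}) = (y_1 + n)\cdot(y_1 + y_2 + n - 1)\cdots(y_1 + \cdots + y_{n-1} + 2) = \prod_{i=1}^{n-1}\Big(\sum_{j=1}^{i} y_j + n + 1 - i\Big), \] with the empty product equal to $1$ when $n = 1$.
   Context: Parking sequences. There are $n$ cars $C_1, \dots, C_n$ of sizes $y_1, \dots, y_n$ (positive integers). There are $\sum_{i=1}^n y_i$ parking spaces in a row, numbered $1, 2, \dots, \sum_{i=1}^n y_i$. Car $C_i$ has a preferred spot $c_i$, a positive integer. The cars park one at a time, in the order $C_1, C_2, \dots, C_n$, by the following rule. Car $C_i$ starts at position $c_i$ and finds the first empty spot $j \geq c_i$. If spots $j, j+1, \dots, j + y_i - 1$ are all empty, the car occupies these spots. If one of the spots $j+1, \dots, j+y_i-1$ is already occupied, a collision occurs. The sequence $(c_1, \dots, c_n)$ is a parking sequence for $\vec{y} = (y_1, \dots, y_n)$ if all $n$ cars park with no collision and no car leaves the $\sum_{i=1}^n y_i$ spaces. A car leaves the spaces if it finds no empty spot $j \geq c_i$, or if its occupied spots would extend past spot $\sum_{i=1}^n y_i$. The number $f(\vec{y})$ counts the sequences $(c_1, \dots, c_n)$ of positive integers that are parking sequences for $\vec{y}$. *)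

theory Defs
  imports Main
begin

text \<open>
  The spots are \<open>1, \<dots>, m\<close> and \<open>occ\<close> is the set of spots already occupied. A driver preferring
  spot \<open>c\<close> moves forward to the first empty spot \<open>j\<close>; there is none exactly when the car leaves
  the row without finding an empty spot.
\<close>

definition first_empty_spot :: "nat \<Rightarrow> nat set \<Rightarrow> nat \<Rightarrow> nat \<Rightarrow> bool" where
  "first_empty_spot m occ c j \<longleftrightarrow>
     j \<in> {1..m} \<and> c \<le> j \<and> j \<notin> occ \<and> (\<forall>k. c \<le> k \<and> k < j \<longrightarrow> k \<in> occ)"

text \<open>
  In the second equation, the first car has size \<open>y\<close> and takes the spots \<open>{j..<j + y}\<close>. Disjointness
  from \<open>occ\<close> excludes a collision, inclusion in \<open>{1..m}\<close> excludes running past the last spot.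
  The last two equations reject lists of sizes and preferences of different lengths.
\<close>

fun all_cars_park :: "nat \<Rightarrow> nat set \<Rightarrow> nat list \<Rightarrow> nat list \<Rightarrow> bool" where
  "all_cars_park m occ [] [] \<longleftrightarrow> True"
| "all_cars_park m occ (y # ys) (c # cs) \<longleftrightarrow>
     (\<exists>j. first_empty_spot m occ c j \<and>
          {j..<j + y} \<inter> occ = {} \<and> {j..<j + y} \<subseteq> {1..m} \<and>
          all_cars_park m (occ \<union> {j..<j + y}) ys cs)"
| "all_cars_park m occ [] (c # cs) \<longleftrightarrow> False"
| "all_cars_park m occ (y # ys) [] \<longleftrightarrow> False"

definition parking_sequence :: "nat list \<Rightarrow> nat list \<Rightarrow> bool" where
  "parking_sequence ys cs \<longleftrightarrow>
     length cs = length ys \<and> (\<forall>c \<in> set cs. 1 \<le> c) \<and> all_cars_park (sum_list ys) {} ys cs"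

definition num_parking_sequences :: "nat list \<Rightarrow> nat" where
  "num_parking_sequences ys = card {cs. parking_sequence ys cs}"

end

theory Submission
  imports Defs
begin

text \<open>
  A car ending at a given place has one plus the length of the occupied run immediately to its left
  as its number of possible preferences. So a parking outcome, that is, a linear order of the cars,
  is obtained from a product of such weights, which does not change if each car is given a hole of
  size 1 that expands to its true size when the car arrives. In this model there are \<open>n\<close> holes; add
  one more that must stay empty and close the row to a circle. Car \<open>i + 1\<close> then chooses among
  \<open>y\<^sub>1 + \<dots> + y\<^sub>i\<close> occupied and \<open>n + 1 - i\<close> empty places, whatever the previous choices
  were. By symmetry each of the \<open>n + 1\<close> holes is equally likely to stay empty, and dividing the
  product of these numbers by \<open>n + 1\<close> cancels its factor \<open>i = 0\<close>.
\<close>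

section \<open>Rows of cells, weights and weighted counts of fillings\<close>

text \<open>
  A row is encoded as a list in which \<open>0\<close> is an empty cell and \<open>y > 0\<close> is a parked car of size \<open>y\<close>.
\<close>

definition weight :: "nat list \<Rightarrow> nat" where
  "weight s = 1 + sum_list (takeWhile (\<lambda>x. x \<noteq> 0) (rev s))"

lemma weight_Nil [simp]: "weight [] = 1"
  by (simp add: weight_def)

lemma weight_snoc [simp]: "weight (s @ [x]) = (if x = 0 then 1 else weight s + x)"
  by (simp add: weight_def)

lemma weight_append_zero: "weight (p @ 0 # q) = weight q"
proof (induction q rule: rev_induct)
  case Nil
  then show ?case by simp
next
  case (snoc x q)
  have "weight (p @ 0 # q @ [x]) = weight ((p @ 0 # q) @ [x])" by simp
  then show ?case using snoc unfolding weight_snoc by simp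
qed

lemma count_list_replicate_zero: "count_list (replicate n (0 :: nat)) 0 = n"
  by (induction n) auto

text \<open>
  Car \<open>y\<close> takes \<open>h y\<close> consecutive empty cells: \<open>h y = y\<close> is the real parking process, \<open>h y = 1\<close> the
  one with expanding holes.
\<close>

primrec fillings :: "(nat \<Rightarrow> nat) \<Rightarrow> nat list \<Rightarrow> nat list \<Rightarrow> nat" where
  "fillings h [] s = (if 0 \<in> set s then 0 else 1)"
| "fillings h (y # ys) s =
     (\<Sum>(p, q) \<in> {(p, q). s = p @ replicate (h y) 0 @ q}. weight p * fillings h ys (p @ y # q))"

lemma finite_splits: "finite {(p, q). s = p @ (u :: 'a list) @ q}"
proof (rule finite_subset)
  show "{(p, q). s = p @ u @ q} \<subseteq> (\<lambda>i. (take i s, drop (i + length u) s)) ` {..length s}"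
  proof clarify
    fix p q assume "s = p @ u @ q"
    then show "(p, q) \<in> (\<lambda>i. (take i (p @ u @ q), drop (i + length u) (p @ u @ q))) ` {..length (p @ u @ q)}"
      by (intro image_eqI[of _ _ "length p"]) auto
  qed
qed simp

section \<open>Independence of the count from the hole sizes\<close>

text \<open>
  To compare different hole sizes, the empty cells are partitioned in advance into holes: \<open>Inl d\<close> is
  a hole reserved for a car of size \<open>d\<close>, and \<open>Inr y\<close> is a parked car.
\<close>

fun cells :: "(nat \<Rightarrow> nat) \<Rightarrow> nat + nat \<Rightarrow> nat list" where
  "cells h (Inl d) = replicate (h d) 0"
| "cells h (Inr y) = [y]"

definition expand :: "(nat \<Rightarrow> nat) \<Rightarrow> (nat + nat) list \<Rightarrow> nat list" where
  "expand h t = concat (map (cells h) t)"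

lemma expand_simps [simp]:
  "expand h [] = []" "expand h (x # t) = cells h x @ expand h t"
  "expand h (t @ t') = expand h t @ expand h t'"
  by (simp_all add: expand_def)

text \<open>A car may only enter a hole reserved for its size. Measuring weights with unit holes
  keeps \<open>h\<close> out of the definition, so one value serves for all hole sizes.\<close>

primrec tile_fillings :: "nat list \<Rightarrow> (nat + nat) list \<Rightarrow> nat" where
  "tile_fillings [] t = (if \<exists>d. Inl d \<in> set t then 0 else 1)"
| "tile_fillings (y # ys) t =
     (\<Sum>(p, q) \<in> {(p, q). t = p @ [Inl y] @ q}.
        weight (expand (\<lambda>_. 1) p) * tile_fillings ys (p @ Inr y # q))"

definition tilings :: "nat set \<Rightarrow> (nat \<Rightarrow> nat) \<Rightarrow> nat list \<Rightarrow> (nat + nat) list set" where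
  "tilings K h s = {t. set t \<subseteq> Inl ` K \<union> Inr ` K \<and> expand h t = s}"

context
  fixes K :: "nat set" and h :: "nat \<Rightarrow> nat"
  assumes K: "finite K" "0 \<notin> K" and h: "\<And>d. d \<in> K \<Longrightarrow> h d \<ge> 1"
begin

lemma length_expand_ge:
  "set t \<subseteq> Inl ` K \<union> Inr ` K \<Longrightarrow> length t \<le> length (expand h t)"
proof (induction t)
  case (Cons x t)
  then show ?case using h by (cases x) (fastforce)+
qed simp

lemma expand_eq_Nil: "set t \<subseteq> Inl ` K \<union> Inr ` K \<Longrightarrow> expand h t = [] \<Longrightarrow> t = []"
  using length_expand_ge[of t] by simp

lemma finite_tilings: "finite (tilings K h s)"
proof (rule finite_subset)
  show "tilings K h s \<subseteq> {t. set t \<subseteq> Inl ` K \<union> Inr ` K \<and> length t \<le> length s}"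
    unfolding tilings_def using length_expand_ge by auto
  show "finite \<dots>" using K by (intro finite_lists_length_le) auto
qed

text \<open>A hole, however large, ends in an empty cell and cuts the run just as a hole of size 1
  does, while a parked car is the single cell \<open>[y]\<close> in both expansions.\<close>

lemma weight_expand:
  "set t \<subseteq> Inl ` K \<union> Inr ` K \<Longrightarrow> weight (expand h t) = weight (expand (\<lambda>_. 1) t)"
proof (induction t rule: rev_induct)
  case (snoc x t)
  show ?case
  proof (cases x)
    case (Inl d)
    then obtain e where "h d = Suc e" using h snoc.prems by (cases "h d") force+
    then have "expand h (t @ [x]) = (expand h t @ replicate e 0) @ [0]"
      using Inl by (simp add: replicate_append_same)
    then have "weight (expand h (t @ [x])) = 1" by (simp only: weight_snoc if_True simp_thms)
    then show ?thesis using Inl by simp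
  next
    case (Inr y)
    then show ?thesis using snoc by simp
  qed
qed simp

text \<open>Of two prefixes of one list, one extends the other by some \<open>us\<close>; here
  \<open>us\<close> expands to nothing, and every tile has at least one cell.\<close>

lemma expand_split_unique:
  assumes "p @ q = p' @ q'" "expand h p = expand h p'"
    and "set p \<subseteq> Inl ` K \<union> Inr ` K" "set p' \<subseteq> Inl ` K \<union> Inr ` K"
  shows "p = p'"
proof -
  obtain us where "p = p' @ us \<or> p' = p @ us"
    using assms(1) unfolding append_eq_append_conv2 by blast
  then show ?thesis using assms(2-4) expand_eq_Nil[of us] by auto
qed

text \<open>A nonzero cell cannot come from a hole, so it is a tile by itself.\<close>

lemma expand_split_exists:
  assumes "expand h t = p @ y # q" "y \<noteq> 0"
  shows "\<exists>p' q'. t = p' @ Inr y # q' \<and> expand h p' = p \<and> expand h q' = q"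
  using assms(1)
proof (induction t arbitrary: p)
  case (Cons x t)
  show ?case
  proof (cases x)
    case (Inl d)
    then have eq: "replicate (h d) 0 @ expand h t = p @ y # q" using Cons.prems by simp
    have "\<exists>us. p = replicate (h d) 0 @ us \<and> expand h t = us @ y # q"
    proof -
      obtain us where us: "replicate (h d) 0 = p @ us \<and> us @ expand h t = y # q \<or>
          replicate (h d) 0 @ us = p \<and> expand h t = us @ y # q"
        using eq unfolding append_eq_append_conv2 by blast
      show ?thesis
      proof (cases us)
        case Nil
        then show ?thesis using us by auto
      next
        case (Cons u us')
        have "y \<notin> set (replicate (h d) 0)" using assms(2) by auto
        then show ?thesis using us Cons by (metis append_Cons in_set_conv_decomp list.inject)
      qed
    qed
    then obtain us where us: "p = replicate (h d) 0 @ us" "expand h t = us @ y # q" by blast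
    from Cons.IH[OF us(2)] obtain p' q' where
      "t = p' @ Inr y # q'" "expand h p' = us" "expand h q' = q" by blast
    then show ?thesis using us Inl by (intro exI[of _ "x # p'"] exI[of _ q']) simp
  next
    case (Inr z)
    show ?thesis
    proof (cases p)
      case Nil
      then show ?thesis using Inr Cons.prems by (intro exI[of _ "[]"] exI[of _ t]) simp
    next
      case (Cons z' p0)
      then have "z' = z" "expand h t = p0 @ y # q" using Inr Cons.prems by simp_all
      from Cons.IH[OF this(2)] obtain p' q' where
        "t = p' @ Inr y # q'" "expand h p' = p0" "expand h q' = q" by blast
      then show ?thesis using Inr Cons \<open>z' = z\<close>
        by (intro exI[of _ "x # p'"] exI[of _ q']) simp
    qed
  qed
qed simp

text \<open>Parking a car and then tiling the new row amounts to tiling the old row and then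
  choosing a hole reserved for that car: turning the new tile \<open>Inr y\<close> back into
  \<open>Inl y\<close> matches the two. With no cars left, a full row has the one tiling
  \<open>map Inr s\<close>, and any other row has a hole in each of its tilings.\<close>

lemma fillings_eq_sum_tilings:
  "set s \<subseteq> insert 0 K \<Longrightarrow> set ys \<subseteq> K \<Longrightarrow>
     fillings h ys s = (\<Sum>t \<in> tilings K h s. tile_fillings ys t)"
proof (induction ys arbitrary: s)
  case Nil
  show ?case
  proof (cases "0 \<in> set s")
    case True
    have "tile_fillings [] t = 0" if "t \<in> tilings K h s" for t
    proof -
      have "\<exists>x \<in> set t. 0 \<in> set (cells h x)"
        using that True by (auto simp: tilings_def expand_def)
      then obtain x where "x \<in> set t" "0 \<in> set (cells h x)" by blast
      moreover have "set t \<subseteq> Inl ` K \<union> Inr ` K" using that by (simp add: tilings_def)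
      ultimately have "\<exists>d. x = Inl d" using K(2) by (cases x) auto
      then show ?thesis using \<open>x \<in> set t\<close> by auto
    qed
    then show ?thesis using True by simp
  next
    case False
    have *: "t = map Inr (expand h t)"
      if "set t \<subseteq> Inl ` K \<union> Inr ` K" "0 \<notin> set (expand h t)" for t
      using that
    proof (induction t)
      case (Cons x t)
      then show ?case using h by (cases x) fastforce+
    qed simp
    have "expand h (map Inr s) = s" by (induction s) auto
    then have "tilings K h s = {map Inr s}"
      using False Nil.prems * by (force simp: tilings_def)
    then show ?thesis using False by auto
  qed
next
  case (Cons y ys)
  have y: "y \<in> K" "y \<noteq> 0" using Cons.prems K(2) by (auto intro: ccontr)
  let ?A = "Inl ` K \<union> Inr ` K"
  \<comment> \<open>The common index set of both double sums: the tiles to the left and to the right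
    of the hole that the current car takes.\<close>
  define X where "X = {(p, q). set p \<subseteq> ?A \<and> set q \<subseteq> ?A \<and>
    expand h p @ replicate (h y) 0 @ expand h q = s}"
  define g where "g = (\<lambda>(p, q). weight (expand (\<lambda>_. 1) p) * tile_fillings ys (p @ Inr y # q))"
  let ?S = "{(p, q). s = p @ replicate (h y) 0 @ q}"
  let ?L = "Sigma ?S (\<lambda>(p, q). tilings K h (p @ y # q))"
  let ?R = "Sigma (tilings K h s) (\<lambda>t. {(p, q). t = p @ [Inl y] @ q})"
  have "fillings h (y # ys) s =
    (\<Sum>(p, q) \<in> ?S. weight p * (\<Sum>t \<in> tilings K h (p @ y # q). tile_fillings ys t))"
    unfolding fillings.simps
  proof (rule sum.cong)
    fix z assume z: "z \<in> ?S"
    obtain p q where pq: "z = (p, q)" by (cases z)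
    have "fillings h ys (p @ y # q) = (\<Sum>t \<in> tilings K h (p @ y # q). tile_fillings ys t)"
      using z pq Cons.prems by (intro Cons.IH) auto
    then show "(case z of (p, q) \<Rightarrow> weight p * fillings h ys (p @ y # q)) = 
      (case z of (p, q) \<Rightarrow> weight p * (\<Sum>t \<in> tilings K h (p @ y # q). tile_fillings ys t))"
      using pq by simp
  qed simp
  also have "\<dots> = (\<Sum>z \<in> ?S. \<Sum>t \<in> (case z of (p, q) \<Rightarrow> tilings K h (p @ y # q)).
      weight (fst z) * tile_fillings ys t)"
    by (intro sum.cong) (auto simp: sum_distrib_left)
  also have "\<dots> = (\<Sum>(z, t) \<in> ?L. weight (fst z) * tile_fillings ys t)"
    by (intro sum.Sigma) (auto intro: finite_tilings finite_splits)
  \<comment> \<open>The cells \<open>(p, q)\<close> tell which tile \<open>Inr y\<close> of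
    \<open>t\<close> is the new car, even if other parked cars have size \<open>y\<close>.\<close>
  also have "\<dots> = sum g X"
  proof (rule sum.reindex_cong[where l="\<lambda>(p, q). ((expand h p, expand h q), p @ Inr y # q)"])
    show "inj_on (\<lambda>(p, q). ((expand h p, expand h q), p @ Inr y # q)) X"
      by (rule inj_onI) (auto simp: X_def dest: expand_split_unique)
    show "?L = (\<lambda>(p, q). ((expand h p, expand h q), p @ Inr y # q)) ` X"
    proof (intro equalityI subsetI)
      fix w assume w: "w \<in> ?L"
      then obtain p q t where 1: "w = ((p, q), t)" "s = p @ replicate (h y) 0 @ q"
        "set t \<subseteq> ?A" "expand h t = p @ y # q" by (auto simp: tilings_def)
      obtain p' q' where "t = p' @ Inr y # q' \<and> expand h p' = p \<and> expand h q' = q"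
        using expand_split_exists[OF 1(4) y(2)] by blast
      then show "w \<in> (\<lambda>(p, q). ((expand h p, expand h q), p @ Inr y # q)) ` X"
        using 1 by (intro image_eqI[of _ _ "(p', q')"]) (auto simp: X_def)
    next
      fix w assume "w \<in> (\<lambda>(p, q). ((expand h p, expand h q), p @ Inr y # q)) ` X"
      then show "w \<in> ?L" using y by (auto simp: X_def tilings_def)
    qed
    show "\<And>x. x \<in> X \<Longrightarrow> (case case x of (p, q) \<Rightarrow> ((expand h p, expand h q), p @ Inr y # q) of
        (z, t) \<Rightarrow> weight (fst z) * tile_fillings ys t) = g x"
      by (auto simp: X_def g_def weight_expand)
  qed
  also have "\<dots> = (\<Sum>(t, z) \<in> ?R. g z)"
  proof (rule sum.reindex_cong[symmetric, where l="\<lambda>(p, q). (p @ [Inl y] @ q, (p, q))"])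
    show "?R = (\<lambda>(p, q). (p @ [Inl y] @ q, (p, q))) ` X"
      using y by (force simp: X_def tilings_def)
  qed (auto simp: inj_on_def)
  also have "\<dots> = (\<Sum>t \<in> tilings K h s. tile_fillings (y # ys) t)"
    unfolding tile_fillings.simps g_def
    by (intro sum.Sigma[symmetric] ballI finite_tilings finite_splits)
  finally show ?case .
qed

text \<open>Each arriving car uses up one hole of its own size, so a nonzero value forces the holes
  of \<open>t\<close> to match \<open>ys\<close>. This fixes the number of empty cells for every
  admissible \<open>h\<close>.\<close>

lemma tile_fillings_nonzero:
  assumes "tile_fillings ys t \<noteq> 0" "set t \<subseteq> Inl ` K \<union> Inr ` K" "set ys \<subseteq> K"
  shows "count_list (expand h t) 0 = sum_list (map h ys)"
  using assms
proof (induction ys arbitrary: t)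
  case Nil
  then have "\<And>d. Inl d \<notin> set t" by (auto split: if_splits)
  then have "0 \<notin> set (expand h t)"
    using Nil.prems K(2) by (auto simp: expand_def)
  then show ?case by (simp add: count_list_0_iff)
next
  case (Cons y ys)
  have "\<exists>p q. t = p @ [Inl y] @ q \<and> tile_fillings ys (p @ Inr y # q) \<noteq> 0"
  proof (rule ccontr)
    assume "\<not> ?thesis"
    then have "tile_fillings (y # ys) t = 0"
      unfolding tile_fillings.simps by (intro sum.neutral) auto
    then show False using Cons.prems(1) by contradiction
  qed
  then obtain p q where pq: "t = p @ [Inl y] @ q" "tile_fillings ys (p @ Inr y # q) \<noteq> 0"
    by blast
  have "count_list (expand h (p @ Inr y # q)) 0 = sum_list (map h ys)"
    using pq Cons.prems by (intro Cons.IH) auto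
  moreover have "y \<noteq> 0" using Cons.prems(3) K(2) by (auto intro: ccontr)
  ultimately show ?case using pq by (simp add: count_list_replicate_zero)
qed

end

text \<open>Separates a condition free of \<open>h\<close> from a count of cells, which
  \<open>tile_fillings_nonzero\<close> supplies. A tile \<open>Inr 0\<close> would expand to an
  empty cell.\<close>

lemma expand_eq_replicate_zero:
  assumes "Inr 0 \<notin> set t"
  shows "expand h t = replicate n 0 \<longleftrightarrow> (\<forall>y. Inr y \<notin> set t) \<and> count_list (expand h t) 0 = n"
proof -
  have 1: "set (expand h t) \<subseteq> {0} \<longleftrightarrow> (\<forall>y. Inr y \<notin> set t)"
    using assms
  proof (induction t)
    case (Cons x t)
    then show ?case by (cases x) (fastforce split: if_splits)+
  qed simp
  have 2: "count_list s 0 = length s" if "set s \<subseteq> {0}" for s :: "nat list"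
    using that by (induction s) auto
  have 3: "s = replicate n 0 \<longleftrightarrow> set s \<subseteq> {0} \<and> length s = n" for s :: "nat list"
    by (auto intro: replicate_eqI)
  show ?thesis using 1 2 3 by metis
qed

lemma fillings_hole_size:
  assumes "0 \<notin> set ys" "\<And>y. y \<in> set ys \<Longrightarrow> h y \<ge> 1"
  shows "fillings h ys (replicate (sum_list (map h ys)) 0) =
         fillings (\<lambda>_. 1) ys (replicate (length ys) 0)"
proof -
  let ?K = "set ys"
  let ?T = "\<lambda>h. tilings ?K h (replicate (sum_list (map h ys)) 0)"
  have sub: "t \<in> ?T h'" if "t \<in> ?T h" "tile_fillings ys t \<noteq> 0"
    "\<And>y. y \<in> ?K \<Longrightarrow> h' y \<ge> 1" for t and h h' :: "nat \<Rightarrow> nat"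
  proof -
    have t: "set t \<subseteq> Inl ` ?K \<union> Inr ` ?K" using that by (simp add: tilings_def)
    then have nz: "Inr 0 \<notin> set t" using assms(1) by auto
    have "\<forall>y. Inr y \<notin> set t"
      using that(1) expand_eq_replicate_zero[OF nz] by (simp add: tilings_def)
    moreover have "count_list (expand h' t) 0 = sum_list (map h' ys)"
      using that t assms by (intro tile_fillings_nonzero) auto
    ultimately show ?thesis
      using t expand_eq_replicate_zero[OF nz] by (simp add: tilings_def)
  qed
  have "fillings h ys (replicate (sum_list (map h ys)) 0) = (\<Sum>t \<in> ?T h. tile_fillings ys t)"
    using assms by (intro fillings_eq_sum_tilings) auto
  \<comment> \<open>Tilings whose holes do not match \<open>ys\<close> must be dropped: they may
    have the right length for one choice of hole sizes and the wrong one for another.\<close>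
  also have "\<dots> = (\<Sum>t \<in> {t \<in> ?T h. tile_fillings ys t \<noteq> 0}. tile_fillings ys t)"
    using assms by (intro sum.mono_neutral_right finite_tilings) auto
  also have "{t \<in> ?T h. tile_fillings ys t \<noteq> 0} = {t \<in> ?T (\<lambda>_. 1). tile_fillings ys t \<noteq> 0}"
    using sub[of _ h "\<lambda>_. 1"] sub[of _ "\<lambda>_. 1" h] assms(2) by blast
  also have "(\<Sum>t \<in> \<dots>. tile_fillings ys t) = (\<Sum>t \<in> ?T (\<lambda>_. 1). tile_fillings ys t)"
    using assms by (intro sum.mono_neutral_left finite_tilings) auto
  also have "\<dots> = fillings (\<lambda>_. 1) ys (replicate (sum_list (map (\<lambda>_. 1) ys)) 0)"
    using assms by (intro fillings_eq_sum_tilings[symmetric]) auto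
  finally show ?thesis by (simp add: sum_list_triv)
qed

section \<open>Unit holes on a circle\<close>

lemma fillings_unit_Cons:
  "fillings (\<lambda>_. 1) (y # ys) s =
     (\<Sum>i<length s. if s ! i = 0 then weight (take i s) * fillings (\<lambda>_. 1) ys (s[i := y]) else 0)"
proof -
  have "fillings (\<lambda>_. 1) (y # ys) s = (\<Sum>i \<in> {i. i < length s \<and> s ! i = 0}.
      weight (take i s) * fillings (\<lambda>_. 1) ys (s[i := y]))"
    unfolding fillings.simps
  proof (rule sum.reindex_cong[where l="\<lambda>i. (take i s, drop (Suc i) s)"])
    show "inj_on (\<lambda>i. (take i s, drop (Suc i) s)) {i. i < length s \<and> s ! i = 0}"
      by (rule inj_on_inverseI[where g="\<lambda>(p, q). length p"]) auto
    show "{(p, q). s = p @ replicate 1 0 @ q} =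
        (\<lambda>i. (take i s, drop (Suc i) s)) ` {i. i < length s \<and> s ! i = 0}"
    proof (intro equalityI subsetI)
      fix z assume "z \<in> {(p, q). s = p @ replicate 1 0 @ q}"
      then obtain p q where "z = (p, q)" "s = p @ 0 # q" by auto
      then show "z \<in> (\<lambda>i. (take i s, drop (Suc i) s)) ` {i. i < length s \<and> s ! i = 0}"
        by (intro image_eqI[of _ _ "length p"]) auto
    qed (auto, metis id_take_nth_drop)
  qed (auto simp: upd_conv_take_nth_drop)
  also have "\<dots> = (\<Sum>i \<in> {..<length s} \<inter> {i. s ! i = 0}.
      weight (take i s) * fillings (\<lambda>_. 1) ys (s[i := y]))"
    by (intro sum.cong) auto
  also have "\<dots> = (\<Sum>i<length s. if s ! i = 0
      then weight (take i s) * fillings (\<lambda>_. 1) ys (s[i := y]) else 0)"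
    by (simp add: sum.If_cases)
  finally show ?thesis .
qed

text \<open>A full turn is the identity, so replacing \<open>k\<close> by \<open>Suc k\<close>
  merely moves the first summand to the end.\<close>

lemma sum_rotate:
  "(\<Sum>r<length a. g (rotate (k + r) a)) = (\<Sum>r<length a. g (rotate r a) :: nat)"
proof (induction k)
  case (Suc k)
  let ?f = "\<lambda>r. g (rotate (k + r) a)"
  have "?f 0 + (\<Sum>r<length a. ?f (Suc r)) = (\<Sum>r<length a. ?f r) + ?f (length a)"
    using sum.lessThan_Suc_shift[of ?f "length a"] sum.lessThan_Suc[of ?f "length a"] by simp
  moreover have "?f (length a) = ?f 0"
    by (simp add: rotate_rotate[symmetric])
  ultimately show ?case using Suc by simp
qed simp

text \<open>An extra hole to the right of the row has weight \<open>weight s\<close>. Every spot,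
  that of the extra hole included, is a preference leading to exactly one hole, so the weights add
  up to the number of spots.\<close>

lemma sum_weight:
  "(\<Sum>i<length s. if s ! i = 0 then weight (take i s) else 0) + weight s =
     sum_list s + count_list s 0 + 1"
proof (induction s rule: rev_induct)
  case (snoc x s)
  have "(\<Sum>i<length s. if (s @ [x]) ! i = 0 then weight (take i (s @ [x])) else 0) =
        (\<Sum>i<length s. if s ! i = 0 then weight (take i s) else 0)"
    by (intro sum.cong) (auto simp: nth_append)
  then show ?case using snoc by simp
qed simp

text \<open>Rotation by \<open>i\<close> brings cell \<open>i\<close> to the front and its left
  neighbours on the circle to the end; their run cannot pass the empty last cell of
  \<open>b\<close>.\<close>

lemma weight_rotate:
  assumes "Suc i < length b" "last b = 0"
  shows "weight (rotate i b) = weight (take i b)"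
proof -
  have "drop i b = butlast (drop i b) @ [0]"
    using assms by (metis append_butlast_last_id drop_eq_Nil2 last_drop linorder_not_less Suc_lessD)
  then have "rotate i b = butlast (drop i b) @ 0 # take i b"
    using assms by (simp add: rotate_drop_take)
  then show ?thesis by (simp add: weight_append_zero)
qed

text \<open>Every spot of the circle leads to exactly one hole, whatever the arrangement. For the
  proof the circle is cut after an empty cell, giving \<open>b\<close>; then
  \<open>weight b = 1\<close> cancels the \<open>1\<close> in \<open>sum_weight\<close>.\<close>

lemma sum_weight_rotate:
  assumes "0 \<in> set a"
  shows "(\<Sum>r<length a. if hd (rotate r a) = 0 then weight (rotate r a) else 0) =
     sum_list a + count_list a 0"
proof -
  obtain p q where a: "a = p @ 0 # q" using assms by (meson split_list)
  define b where "b = (q @ p) @ [0]"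
  define g where "g c = (if hd c = 0 then weight c else 0)" for c
  have b: "b = rotate (Suc (length p)) a" using rotate_append[of "p @ [0]" q] by (simp add: a b_def)
  have len: "length b = length a" by (simp add: a b_def)
  have "(\<Sum>r<length a. g (rotate r a)) = (\<Sum>r<length a. g (rotate r b))"
    using sum_rotate[of g "Suc (length p)" a] by (simp only: b rotate_rotate add.commute)
  also have "\<dots> = (\<Sum>r<length a. if b ! r = 0 then weight (take r b) else 0)"
  proof (rule sum.cong)
    fix r assume "r \<in> {..<length a}"
    then have r: "r < length b" using len by simp
    have "drop r b = butlast (drop r b) @ [0]"
      using r by (metis append_butlast_last_id b_def drop_eq_Nil2 last_drop last_snoc linorder_not_less)
    then have "rotate r b = butlast (drop r b) @ 0 # take r b"
      using r by (simp add: rotate_drop_take)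
    then have "weight (rotate r b) = weight (take r b)" by (simp add: weight_append_zero)
    moreover have "hd (rotate r b) = b ! r" using r by (simp add: rotate_drop_take hd_drop_conv_nth)
    ultimately show "g (rotate r b) = (if b ! r = 0 then weight (take r b) else 0)"
      by (simp add: g_def)
  qed simp
  also have "\<dots> = sum_list b + count_list b 0"
  proof -
    have "weight b = 1" "length b = length a" using weight_snoc[of "q @ p" 0] len by (simp_all add: b_def)
    then show ?thesis using sum_weight[of b] by simp
  qed
  also have "\<dots> = sum_list a + count_list a 0" by (simp add: a b_def)
  finally show ?thesis by (simp add: g_def)
qed

text \<open>
  The circle is cut in all possible ways just after a hole, which is the hole that stays empty.
\<close>

definition circular_fillings :: "nat list \<Rightarrow> nat list \<Rightarrow> nat" where
  "circular_fillings ys a = (\<Sum>r<length a. if last (rotate r a) = 0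
     then fillings (\<lambda>_. 1) ys (butlast (rotate r a)) else 0)"

text \<open>Two sums are interchanged: over the cut and over the place of the first car. After
  rotation by \<open>sum_rotate\<close>, the place of the car becomes the outer index.\<close>

lemma circular_fillings_Cons:
  assumes "y \<noteq> 0"
  shows "circular_fillings (y # ys) a =
    (\<Sum>r<length a. if hd (rotate r a) = 0
       then weight (rotate r a) * circular_fillings ys ((rotate r a)[0 := y]) else 0)"
proof (cases "a = []")
  case False
  define N where "N = length a"
  have N: "N > 0" using False by (simp add: N_def)
  define g where "g d = (if last d = 0 then fillings (\<lambda>_. 1) ys (butlast d) else 0)" for d
  \<comment> \<open>Here \<open>c\<close> is the circle read from the place of the car; rotating by
    \<open>N - i\<close> restores the cut, with the car at index \<open>i\<close>.\<close>
  define f where "f i c = (if hd c = 0 then weight c * g (rotate (N - i) (c[0 := y])) else 0)" for i c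
  have step: "(if last b = 0 then fillings (\<lambda>_. 1) (y # ys) (butlast b) else 0) =
      (\<Sum>i<N. f i (rotate i b))" if b: "length b = N" for b
  proof -
    obtain M where M: "N = Suc M" using N by (cases N) auto
    have b0: "b \<noteq> []" using b N by auto
    have rot: "rotate (N - i) ((rotate i b)[0 := y]) = b[i := y]" if "i < N" for i
    proof -
      have "(rotate i b)[0 := y] = rotate i (b[i := y])"
        using that b drop_update_swap[of i i b y]
        by (simp add: rotate_drop_take list_update_append)
      then show ?thesis using that b
        by (simp add: rotate_rotate)
    qed
    have hd: "hd (rotate i b) = b ! i" if "i < N" for i
      using that b by (simp add: rotate_drop_take hd_drop_conv_nth)
    \<comment> \<open>Index \<open>M\<close> is the cell at the cut. A car parked there makes the
      last cell \<open>y\<close>, which is nonzero, so this summand vanishes.\<close>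
    have "f M (rotate M b) = 0"
      using rot[of M] assms b M b0 by (simp add: f_def g_def last_list_update)
    moreover have "f i (rotate i b) = (if last b = 0 then if butlast b ! i = 0
        then weight (take i (butlast b)) * fillings (\<lambda>_. 1) ys ((butlast b)[i := y]) else 0 else 0)"
      if "i < M" for i
    proof -
      have "last (b[i := y]) = last b" "butlast (b[i := y]) = (butlast b)[i := y]"
        using that M b b0 by (auto simp: last_list_update butlast_list_update)
      moreover have "butlast b ! i = b ! i" "take i (butlast b) = take i b"
        using that M b by (auto simp: nth_butlast take_butlast)
      ultimately show ?thesis
        using that M b rot[of i] hd[of i] weight_rotate[of i b] by (simp add: f_def g_def)
    qed
    ultimately have "(\<Sum>i<N. f i (rotate i b)) = (\<Sum>i<M. if last b = 0 then if butlast b ! i = 0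
        then weight (take i (butlast b)) * fillings (\<lambda>_. 1) ys ((butlast b)[i := y]) else 0 else 0)"
      by (simp add: M)
    then show ?thesis
      unfolding fillings_unit_Cons using b M by simp
  qed
  have "circular_fillings (y # ys) a = (\<Sum>r<N. \<Sum>i<N. f i (rotate (i + r) a))"
    unfolding circular_fillings_def N_def[symmetric]
    by (intro sum.cong refl) (subst step, auto simp: N_def rotate_rotate)
  also have "\<dots> = (\<Sum>i<N. \<Sum>r<N. f i (rotate (i + r) a))"
    by (rule sum.swap)
  also have "\<dots> = (\<Sum>i<N. \<Sum>r<N. f i (rotate r a))"
    unfolding N_def by (intro sum.cong refl sum_rotate)
  also have "\<dots> = (\<Sum>r<N. \<Sum>i<N. f i (rotate r a))"
    by (rule sum.swap)
  also have "\<dots> = (\<Sum>r<N. if hd (rotate r a) = 0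
       then weight (rotate r a) * circular_fillings ys ((rotate r a)[0 := y]) else 0)"
  proof (intro sum.cong refl)
    fix r
    let ?d = "(rotate r a)[0 := y]"
    \<comment> \<open>For \<open>i < N\<close> the amount \<open>N - i\<close> runs through
      \<open>1..N\<close>, a full turn shifted by one.\<close>
    have "(\<Sum>i<N. g (rotate (N - i) ?d)) = (\<Sum>i<N. g (rotate (1 + i) ?d))"
    proof -
      have "(\<Sum>i<N. g (rotate (N - i) ?d)) = (\<Sum>i<N. g (rotate (1 + (N - Suc i)) ?d))"
        by (intro sum.cong refl) (simp add: Suc_diff_Suc del: rotate_Suc)
      then show ?thesis using sum.nat_diff_reindex[of "\<lambda>i. g (rotate (1 + i) ?d)" N] by simp
    qed
    also have "\<dots> = circular_fillings ys ?d"
      using sum_rotate[of g 1 ?d] by (simp add: circular_fillings_def g_def N_def)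
    finally have "(\<Sum>i<N. g (rotate (N - i) ?d)) = circular_fillings ys ?d" .
    then show "(\<Sum>i<N. f i (rotate r a)) = (if hd (rotate r a) = 0
       then weight (rotate r a) * circular_fillings ys ((rotate r a)[0 := y]) else 0)"
      by (simp add: f_def flip: sum_distrib_left)
  qed
  finally show ?thesis by (simp add: N_def)
qed (simp add: circular_fillings_def)

lemma sum_list_rotate: "sum_list (rotate r a) = sum_list (a :: nat list)"
proof (induction r)
  case (Suc r)
  then show ?case by (cases "rotate r a") simp_all
qed simp

lemma count_list_rotate: "count_list (rotate r a) x = count_list a x"
proof (induction r)
  case (Suc r)
  then show ?case by (cases "rotate r a") (auto split: if_splits)
qed simp

text \<open>By \<open>sum_weight_rotate\<close> the first car contributes
  \<open>sum_list a + count_list a 0\<close>. Wherever it parks, it raises the sum by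
  \<open>y\<close> and lowers the number of empty cells by one, hence \<open>- i\<close>.\<close>

lemma circular_fillings_eq_prod:
  assumes "0 \<notin> set ys" "count_list a 0 = Suc (length ys)"
  shows "circular_fillings ys a = (\<Prod>i<length ys. sum_list a + sum_list (take i ys) + Suc (length ys) - i)"
  using assms
proof (induction ys arbitrary: a)
  case Nil
  then have "0 \<in> set a" by (metis count_notin list.size(3) nat.distinct(1))
  then obtain p q where a: "a = p @ 0 # q" by (meson split_list)
  have pq: "0 \<notin> set (q @ p)" using Nil by (simp add: a count_list_0_iff)
  define g where "g d = (if last d = 0 then fillings (\<lambda>_. 1) [] (butlast d) else 0)" for d
  have b: "(q @ p) @ [0] = rotate (Suc (length p)) a"
    using rotate_append[of "p @ [0]" q] by (simp add: a)
  have "circular_fillings [] a = (\<Sum>r<length a. g (rotate r ((q @ p) @ [0])))"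
    using sum_rotate[of g "Suc (length p)" a]
    by (simp only: b rotate_rotate add.commute circular_fillings_def g_def)
  \<comment> \<open>The only hole is in last place, so every rotation with
    \<open>0 < r < length a\<close> ends in a nonzero cell.\<close>
  also have "\<dots> = (\<Sum>r<length a. if r = 0 then 1 else 0)"
  proof (intro sum.cong refl)
    fix r assume "r \<in> {..<length a}"
    then have r: "r \<le> length (q @ p)" by (simp add: a)
    show "g (rotate r ((q @ p) @ [0])) = (if r = 0 then 1 else 0)"
    proof (cases r)
      case 0
      then show ?thesis using pq by (simp add: g_def butlast_append)
    next
      case (Suc k)
      have "last (rotate r ((q @ p) @ [0])) = last (take r (q @ p))"
        using r Suc by (auto simp: rotate_drop_take last_append)
      moreover have "last (take r (q @ p)) \<in> set (q @ p)"
        using r Suc by (intro in_set_takeD[OF last_in_set]) auto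
      ultimately have "last (rotate r ((q @ p) @ [0])) \<noteq> 0" using pq by metis
      then show ?thesis using Suc by (simp only: g_def if_False) simp
    qed
  qed
  finally show ?case by (simp add: a)
next
  case (Cons y ys)
  let ?P = "\<Prod>i<length ys. sum_list a + y + sum_list (take i ys) + Suc (length ys) - i"
  have y: "y \<noteq> 0" using Cons.prems by auto
  have a0: "0 \<in> set a" using Cons.prems by (metis count_notin nat.distinct(1))
  have "circular_fillings ys ((rotate r a)[0 := y]) = ?P" if hd: "hd (rotate r a) = 0" for r
  proof -
    obtain c where c: "rotate r a = 0 # c"
      using hd a0 by (cases "rotate r a") auto
    have "sum_list (0 # c) = sum_list a" "count_list (0 # c) 0 = count_list a 0"
      unfolding c[symmetric] by (rule sum_list_rotate, rule count_list_rotate)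
    then show ?thesis using Cons.prems y by (subst Cons.IH) (auto simp: c add.commute[of y])
  qed
  then have "circular_fillings (y # ys) a =
     (\<Sum>r<length a. (if hd (rotate r a) = 0 then weight (rotate r a) else 0) * ?P)"
    unfolding circular_fillings_Cons[OF y] by (intro sum.cong) auto
  also have "\<dots> = (sum_list a + count_list a 0) * ?P"
    using sum_weight_rotate[OF a0] by (simp add: sum_distrib_right[symmetric])
  also have "\<dots> = (\<Prod>i<length (y # ys).
      sum_list a + sum_list (take i (y # ys)) + Suc (length (y # ys)) - i)"
    using Cons.prems unfolding length_Cons prod.lessThan_Suc_shift by (simp add: add.assoc)
  finally show ?case .
qed

lemma fillings_unit:
  assumes "0 \<notin> set ys" "ys \<noteq> []"
  shows "fillings (\<lambda>_. 1) ys (replicate (length ys) 0) =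
    (\<Prod>i = 1..length ys - 1. sum_list (take i ys) + length ys + 1 - i)"
proof -
  let ?n = "length ys" and ?a = "replicate (Suc (length ys)) (0 :: nat)"
  obtain k where k: "?n = Suc k" using assms(2) by (cases ys) auto
  \<comment> \<open>All cuts of the empty circle give the same row, so the circular count is
    \<open>Suc ?n\<close> times the linear one.\<close>
  have "rotate r ?a = ?a" for r
  proof (rule replicate_eqI)
    fix x assume "x \<in> set (rotate r ?a)"
    then show "x = 0" unfolding set_rotate by (simp only: in_set_replicate)
  qed (simp only: length_rotate length_replicate)
  moreover have "last ?a = 0" "butlast ?a = replicate ?n 0"
    by (simp_all only: replicate_Suc replicate_append_same[symmetric] last_snoc butlast_snoc)
  ultimately have "circular_fillings ys ?a = Suc ?n * fillings (\<lambda>_. 1) ys (replicate ?n 0)"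
    unfolding circular_fillings_def by (simp only: if_True simp_thms sum_constant card_lessThan length_replicate of_nat_id)
  moreover have "circular_fillings ys ?a = (\<Prod>i<?n. sum_list (take i ys) + Suc ?n - i)"
    using circular_fillings_eq_prod[OF assms(1), of ?a]
    by (simp only: count_list_replicate_zero sum_list_replicate mult_0_right add_0_left)
  \<comment> \<open>At \<open>i = 0\<close> the partial sum is 0 and the factor is
    \<open>Suc ?n\<close>, the number of cuts.\<close>
  moreover have "(\<Prod>i<?n. sum_list (take i ys) + Suc ?n - i) = Suc ?n * (\<Prod>i = 1..?n - 1. sum_list (take i ys) + ?n + 1 - i)"
    unfolding k prod.lessThan_Suc_shift by (simp add: prod.atLeast1_atMost_eq)
  ultimately have "Suc ?n * fillings (\<lambda>_. 1) ys (replicate ?n 0) =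
      Suc ?n * (\<Prod>i = 1..?n - 1. sum_list (take i ys) + ?n + 1 - i)" by (simp only:)
  then show ?thesis by (simp only: Suc_mult_cancel1)
qed


section \<open>From preference lists to fillings\<close>

definition extent :: "nat list \<Rightarrow> nat" where
  "extent s = sum_list (map (max 1) s)"

lemma extent_simps [simp]:
  "extent [] = 0" "extent (x # s) = max 1 x + extent s" "extent (s @ t) = extent s + extent t"
  by (simp_all add: extent_def)

lemma extent_zeros [simp]: "extent (replicate n 0) = n"
  by (induction n) auto

lemma extent_eq_0_iff [simp]: "extent s = 0 \<longleftrightarrow> s = []"
  by (cases s) auto

text \<open>The row begins at spot \<open>k\<close>. An empty cell stands for one spot and a car
  \<open>y > 0\<close> for \<open>y\<close> spots, hence \<open>max 1\<close> here and in
  \<open>extent\<close>.\<close>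

primrec occupied :: "nat \<Rightarrow> nat list \<Rightarrow> nat set" where
  "occupied k [] = {}"
| "occupied k (x # s) = {k..<k + x} \<union> occupied (k + max 1 x) s"

lemma occupied_append [simp]:
  "occupied k (s @ t) = occupied k s \<union> occupied (k + extent s) t"
  by (induction s arbitrary: k) (auto simp: add.assoc)

lemma occupied_zeros [simp]: "occupied k (replicate n 0) = {}"
  by (induction n arbitrary: k) auto

lemma occupied_subset: "occupied k s \<subseteq> {k..<k + extent s}"
proof (induction s arbitrary: k)
  case (Cons x s)
  then show ?case using Cons.IH[of "k + max 1 x"] by fastforce
qed simp

text \<open>If the first spot is free, the first cell is no car; repeating this turns absence of
  collision into a block of empty cells.\<close>

lemma zeros_prefix:
  "y \<le> extent s \<Longrightarrow> {k..<k + y} \<inter> occupied k s = {} \<Longrightarrow> \<exists>q. s = replicate y 0 @ q"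
proof (induction y arbitrary: k s)
  case (Suc y)
  then obtain x s' where s: "s = x # s'" by (cases s) auto
  have "k \<in> {k..<k + Suc y}" by simp
  then have "k \<notin> occupied k s" using Suc.prems(2) by blast
  then have "x = 0" by (auto simp: s)
  have "{Suc k..<Suc k + y} \<subseteq> {k..<k + Suc y}" by auto
  moreover have "occupied k s = occupied (Suc k) s'" using \<open>x = 0\<close> by (simp add: s)
  ultimately have "{Suc k..<Suc k + y} \<inter> occupied (Suc k) s' = {}"
    using Suc.prems(2) by blast
  then have "\<exists>q. s' = replicate y 0 @ q"
    using Suc.prems(1) \<open>x = 0\<close> by (intro Suc.IH[of _ "Suc k"]) (simp_all add: s)
  then show ?case using \<open>x = 0\<close> by (auto simp: s)
qed simp

lemma empty_spot_split:
  "j \<in> {k..<k + extent s} \<Longrightarrow> j \<notin> occupied k s \<Longrightarrow> \<exists>p q. s = p @ 0 # q \<and> j = k + extent p"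
proof (induction s arbitrary: k)
  case (Cons x s)
  show ?case
  proof (cases "x = 0 \<and> j = k")
    case True
    then show ?thesis by (intro exI[of _ "[]"] exI[of _ s]) simp
  next
    case False
    then have "j \<in> {k + max 1 x..<k + max 1 x + extent s}" "j \<notin> occupied (k + max 1 x) s"
      using Cons.prems by (auto simp: max_def split: if_splits)
    from Cons.IH[OF this] obtain p q where "s = p @ 0 # q" "j = k + max 1 x + extent p" by blast
    then show ?thesis by (intro exI[of _ "x # p"] exI[of _ q]) simp
  qed
qed simp

text \<open>The car stops just after \<open>p\<close> if it prefers that spot, which gives the 1 in
  \<open>weight\<close>, or a spot of the occupied run ending there.\<close>

lemma card_preferences:
  "card {c. k \<le> c \<and> c \<le> k + extent p \<and> {c..<k + extent p} \<subseteq> occupied k p} = weight p"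
proof (induction p rule: rev_induct)
  case Nil
  have "{c. k \<le> c \<and> c \<le> k} = {k}" by auto
  then show ?case by (simp add: order.antisym conj_commute cong: conj_cong)
next
  case (snoc x p)
  let ?C = "\<lambda>p. {c. k \<le> c \<and> c \<le> k + extent p \<and> {c..<k + extent p} \<subseteq> occupied k p}"
  let ?e = "k + extent p"
  have sub: "occupied k p \<subseteq> {k..<?e}" by (rule occupied_subset)
  show ?case
  proof (cases "x = 0")
    case True
    have "?C (p @ [x]) = {Suc ?e}"
    proof (intro equalityI subsetI)
      fix c assume c: "c \<in> ?C (p @ [x])"
      have "?e \<notin> occupied k p" using sub by auto
      then have "?e \<notin> {c..<Suc ?e}" using c True by auto
      then show "c \<in> {Suc ?e}" using c True by auto
    qed (use True in auto)
    then show ?thesis using True by simp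
  next
    case False
    \<comment> \<open>The spot \<open>?e\<close> already belongs to \<open>?C p\<close>, so the last
      car adds just \<open>x\<close> preferences.\<close>
    have "?C (p @ [x]) = ?C p \<union> {Suc ?e..?e + x}"
    proof (intro equalityI subsetI)
      fix c assume c: "c \<in> ?C (p @ [x])"
      show "c \<in> ?C p \<union> {Suc ?e..?e + x}"
      proof (cases "c \<le> ?e")
        case True
        have "{c..<?e} \<subseteq> occupied k p"
        proof
          fix i assume i: "i \<in> {c..<?e}"
          then have "i \<in> occupied k (p @ [x])" using c by (auto dest!: subsetD)
          then show "i \<in> occupied k p" using i by auto
        qed
        then show ?thesis using c True by auto
      qed (use c False in auto)
    next
      fix c assume c: "c \<in> ?C p \<union> {Suc ?e..?e + x}"
      have "{c..<?e} \<subseteq> occupied k p" using c by auto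
      then have "{c..<?e + x} \<subseteq> occupied k p \<union> {?e..<?e + x}" by fastforce
      then show "c \<in> ?C (p @ [x])" using c False by (auto simp: add.assoc)
    qed
    also have "card \<dots> = card (?C p) + x"
      by (subst card_Un_disjoint) auto
    finally show ?thesis using snoc False by simp
  qed
qed

text \<open>Preference lists are sorted by the split of \<open>s\<close> at which the first car
  parks. The condition on empty cells makes the final row full; finiteness is carried along for the
  cardinality of the union.\<close>

lemma card_all_cars_park:
  assumes "count_list s 0 = sum_list ys" "0 \<notin> set ys"
  shows "finite {cs. (\<forall>c \<in> set cs. 1 \<le> c) \<and> all_cars_park (extent s) (occupied 1 s) ys cs} \<and>
    card {cs. (\<forall>c \<in> set cs. 1 \<le> c) \<and> all_cars_park (extent s) (occupied 1 s) ys cs} =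
      fillings (\<lambda>y. y) ys s"
  using assms
proof (induction ys arbitrary: s)
  case Nil
  have "{cs. (\<forall>c \<in> set cs. 1 \<le> c) \<and> all_cars_park (extent s) (occupied 1 s) [] cs} = {[]}"
    by (auto elim: all_cars_park.elims)
  then show ?case using Nil by (auto simp: count_list_0_iff)
next
  case (Cons y ys)
  define B where "B s = {cs. (\<forall>c \<in> set cs. 1 \<le> c) \<and> all_cars_park (extent s) (occupied 1 s) ys cs}" for s
  define C where "C p = {c. 1 \<le> c \<and> first_empty_spot (extent s) (occupied 1 s) c (1 + extent p)}" for p
  let ?S = "{(p, q). s = p @ replicate y 0 @ q}"
  define T where "T = (\<lambda>(p, q). (\<lambda>(c, cs). c # cs) ` (C p \<times> B (p @ y # q)))"
  have y: "y \<ge> 1" using Cons.prems by (cases y) auto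
  have C: "finite (C p)" "card (C p) = weight p" if s: "s = p @ replicate y 0 @ q" for p q
  proof -
    \<comment> \<open>Occupied spots before \<open>1 + extent p\<close> belong to cars of
      \<open>p\<close>, so the condition on \<open>c\<close> concerns \<open>p\<close>
      alone.\<close>
    have "C p = {c. 1 \<le> c \<and> c \<le> 1 + extent p \<and> {c..<1 + extent p} \<subseteq> occupied 1 p}"
      using y occupied_subset[of 1 p] occupied_subset[of "1 + extent p + y" q]
      unfolding C_def first_empty_spot_def s by fastforce
    then show "finite (C p)" "card (C p) = weight p" using card_preferences[of 1 p] by simp_all
  qed
  have B: "finite (B (p @ y # q))" "card (B (p @ y # q)) = fillings (\<lambda>y. y) ys (p @ y # q)"
    if "s = p @ replicate y 0 @ q" for p q
    using Cons.IH[of "p @ y # q"] Cons.prems y that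
    by (auto simp: B_def count_list_replicate_zero)
  have inj: "inj_on (\<lambda>(c, cs). c # cs) X" for X :: "(nat \<times> nat list) set"
    by (auto simp: inj_on_def)
  have T: "finite (T z)" "card (T z) = (case z of (p, q) \<Rightarrow> weight p * fillings (\<lambda>y. y) ys (p @ y # q))"
    if "z \<in> ?S" for z
    using that B C by (auto simp: T_def card_image[OF inj] card_cartesian_product)
  have disj: "T z \<inter> T z' = {}" if z: "z \<in> ?S" "z' \<in> ?S" "z \<noteq> z'" for z z'
  proof (rule ccontr)
    assume "T z \<inter> T z' \<noteq> {}"
    obtain p q p' q' where pq: "z = (p, q)" "z' = (p', q')" by (cases z, cases z')
    obtain c where c: "c \<in> C p" "c \<in> C p'" using \<open>T z \<inter> T z' \<noteq> {}\<close> by (auto simp: T_def pq)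
    \<comment> \<open>The first empty spot is determined by \<open>c\<close>.\<close>
    then have "1 + extent p = 1 + extent p'"
      unfolding C_def first_empty_spot_def by (metis (mono_tags, lifting) linorder_neqE_nat mem_Collect_eq)
    moreover obtain us where "p = p' @ us \<or> p' = p @ us"
      using z pq by (auto simp: append_eq_append_conv2)
    ultimately have "p = p'" by auto
    then show False using z pq by auto
  qed
  have "{cs. (\<forall>c \<in> set cs. 1 \<le> c) \<and> all_cars_park (extent s) (occupied 1 s) (y # ys) cs} = (\<Union>z \<in> ?S. T z)"
  proof (intro equalityI subsetI)
    fix xs assume xs: "xs \<in> {cs. (\<forall>c \<in> set cs. 1 \<le> c) \<and> all_cars_park (extent s) (occupied 1 s) (y # ys) cs}"
    then obtain c cs where cs: "xs = c # cs" by (cases xs) auto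
    with xs obtain j where j: "first_empty_spot (extent s) (occupied 1 s) c j"
      "{j..<j + y} \<inter> occupied 1 s = {}" "{j..<j + y} \<subseteq> {1..extent s}"
      "all_cars_park (extent s) (occupied 1 s \<union> {j..<j + y}) ys cs" by auto
    have "j \<in> {1..<1 + extent s}" "j \<notin> occupied 1 s"
      using j(1) by (auto simp: first_empty_spot_def)
    from empty_spot_split[OF this] obtain p r where p: "s = p @ 0 # r" "j = 1 + extent p" by blast
    have "j + y - 1 \<in> {j..<j + y}" using y by auto
    then have "j + y - 1 \<le> extent s" using j(3) by auto
    then have "\<exists>q. 0 # r = replicate y 0 @ q"
      using j(2) p by (intro zeros_prefix[of _ _ j]) auto
    then obtain q where s: "s = p @ replicate y 0 @ q" using p by auto
    \<comment> \<open>A car of size \<open>y\<close> covers the same spots as the \<open>y\<close>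
      empty cells it replaces, so \<open>extent\<close> is unchanged.\<close>
    have "occupied 1 s \<union> {j..<j + y} = occupied 1 (p @ y # q)" "extent s = extent (p @ y # q)"
      using y p(2) by (auto simp: s)
    then have "xs \<in> T (p, q)" using xs j cs p(2) by (auto simp: T_def B_def C_def)
    then show "xs \<in> (\<Union>z \<in> ?S. T z)" using s by blast
  next
    fix xs assume "xs \<in> (\<Union>z \<in> ?S. T z)"
    then obtain p q c cs where s: "s = p @ replicate y 0 @ q" and xs: "xs = c # cs" "c \<in> C p"
      "cs \<in> B (p @ y # q)" by (auto simp: T_def)
    let ?j = "1 + extent p"
    have "occupied 1 s \<union> {?j..<?j + y} = occupied 1 (p @ y # q)" "extent s = extent (p @ y # q)"
      using y by (auto simp: s)
    moreover have "{?j..<?j + y} \<inter> occupied 1 s = {}" "{?j..<?j + y} \<subseteq> {1..extent s}"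
      using occupied_subset[of 1 p] occupied_subset[of "?j + y" q] by (fastforce simp: s)+
    ultimately have "all_cars_park (extent s) (occupied 1 s) (y # ys) (c # cs)"
      using xs unfolding all_cars_park.simps by (intro exI[of _ ?j]) (simp add: B_def C_def)
    then show "xs \<in> {cs. (\<forall>c \<in> set cs. 1 \<le> c) \<and> all_cars_park (extent s) (occupied 1 s) (y # ys) cs}"
      using xs by (simp add: B_def C_def)
  qed
  moreover have "card (\<Union>z \<in> ?S. T z) = (\<Sum>z \<in> ?S. card (T z))"
    using T disj by (intro card_UN_disjoint finite_splits) auto
  moreover have "finite (\<Union>z \<in> ?S. T z)" using T by (intro finite_UN_I finite_splits)
  ultimately show ?case using T by simp
qed

lemma length_if_all_cars_park: "all_cars_park m occ ys cs \<Longrightarrow> length cs = length ys"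
  by (induction m occ ys cs rule: all_cars_park.induct) auto

theorem theorem1:
  fixes n :: nat and ys :: "nat list"
  assumes "n \<ge> 1"
    and "length ys = n"
    and "\<forall>y \<in> set ys. 1 \<le> y"
  shows "num_parking_sequences ys =
    (\<Prod>i = 1..n - 1. (\<Sum>j = 1..i. ys ! (j - 1)) + n + 1 - i)"
proof -
  have ys: "0 \<notin> set ys" "ys \<noteq> []" using assms by force+
  let ?s = "replicate (sum_list ys) (0 :: nat)"
  \<comment> \<open>The row \<open>?s\<close> has extent \<open>sum_list ys\<close> and no occupied
    spot: it is the initial state.\<close>
  have "num_parking_sequences ys = card {cs. (\<forall>c \<in> set cs. 1 \<le> c) \<and>
      all_cars_park (extent ?s) (occupied 1 ?s) ys cs}"
    unfolding num_parking_sequences_def parking_sequence_def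
    by (intro arg_cong[of _ _ card]) (auto dest: length_if_all_cars_park)
  also have "\<dots> = fillings (\<lambda>y. y) ys ?s"
    using card_all_cars_park[of ?s ys] ys by (simp add: count_list_replicate_zero)
  also have "\<dots> = fillings (\<lambda>_. 1) ys (replicate (length ys) 0)"
    using fillings_hole_size[of ys "\<lambda>y. y"] ys assms by simp
  also have "\<dots> = (\<Prod>i = 1..n - 1. sum_list (take i ys) + n + 1 - i)"
    using fillings_unit[OF ys] assms by simp
  also have "\<dots> = (\<Prod>i = 1..n - 1. (\<Sum>j = 1..i. ys ! (j - 1)) + n + 1 - i)"
  proof (intro prod.cong refl)
    fix i assume "i \<in> {1..n - 1}"
    then have "i \<le> length ys" using assms by auto
    then have "sum_list (take i ys) = (\<Sum>j = 1..i. ys ! (j - 1))"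
      by (simp add: sum_list_sum_nth atLeast0LessThan min_absorb2 sum.atLeast1_atMost_eq)
    then show "sum_list (take i ys) + n + 1 - i = (\<Sum>j = 1..i. ys ! (j - 1)) + n + 1 - i" by simp
  qed
  finally show ?thesis .
qed

end
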